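(* There is a sequence of polynomials $p_0(x),p_1(x),\ldots$ such that for all $k\ge0$, $$A_{2n}^{=n+k}=p_k(n)\,(2n-1)!!\quad\text{for all } n\ge k+1.$$ Moreover $p_0(x)=1$, and for $k\ge1$ the values $p_k(n)$ are given by the recursion $$p_k(n)=\frac{B_{2k+1}(1)}{(2k+1)!!}+\sum_{j=1}^k\sum_{t=k+2}^n\frac{B_{2j+1}(1)\,2^j\,(t-1)\!\downarrow_j}{(2j+1)!}\,p_{k-j}(t-j-1).$$
   Context: For $\sigma=\sigma_1\ldots\sigma_n\in S_n$, let $\mathrm{mmp}^{(1,0,0,0)}(\sigma)$ be the number of indices $i$ such that there exists $j>i$ with $\sigma_j>\sigma_i$. $UD_n$ is the set of up-down permutations in $S_n$ ($\sigma_1<\sigma_2>\sigma_3<\sigma_4>\cdots$). $A_{2n}^{=m}$ denotes the number of $\sigma\in UD_{2n}$ with $\mathrm{mmp}^{(1,0,0,0)}(\sigma)=m$. $B_{2j+1}(1)=|UD_{2j+1}|$ is the number of up-down permutations of length $2j+1$. $(2n-1)!!=\prod_{i=1}^n(2i-1)$, and $(y)\!\downarrow_j=y(y-1)\cdots(y-j+1)$ for $j\ge1$, $(y)\!\downarrow_0=1$. *)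

theory Defs
  imports
    Complex_Main
    "HOL-Combinatorics.Permutations"
    "HOL-Computational_Algebra.Polynomial"
begin

(* A permutation sigma in S_n is a function on nat permuting {1..n}; sigma i is sigma_i. *)

definition up_down_perms :: "nat \<Rightarrow> (nat \<Rightarrow> nat) set" where
  "up_down_perms n =
     {\<sigma>. \<sigma> permutes {1..n} \<and>
          (\<forall>i\<in>{1..<n}. if odd i then \<sigma> i < \<sigma> (Suc i) else \<sigma> i > \<sigma> (Suc i))}"

(* mmp^(1,0,0,0)(sigma) for sigma in S_n *)
definition mmp1000 :: "nat \<Rightarrow> (nat \<Rightarrow> nat) \<Rightarrow> nat" where
  "mmp1000 n \<sigma> = card {i \<in> {1..n}. \<exists>j\<in>{1..n}. i < j \<and> \<sigma> i < \<sigma> j}"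

(* A N m is the number A_N^(=m); the theorem uses it for even N. *)
definition A :: "nat \<Rightarrow> nat \<Rightarrow> nat" where
  "A N m = card {\<sigma> \<in> up_down_perms N. mmp1000 N \<sigma> = m}"

(* B_at_1 N is B_N(1), the value at 1 of the polynomial enumerating up-down
   permutations of length N by mmp^(1,0,0,0); the theorem uses it for odd N. *)
definition B_at_1 :: "nat \<Rightarrow> nat" where
  "B_at_1 N = card (up_down_perms N)"

(* odd_double_fact n is (2n-1)!!, hence (2k+1)!! is odd_double_fact (k+1). *)
definition odd_double_fact :: "nat \<Rightarrow> nat" where
  "odd_double_fact n = (\<Prod>i=1..n. 2 * i - 1)"

definition falling :: "real \<Rightarrow> nat \<Rightarrow> real" where
  "falling y j = (\<Prod>i<j. y - real i)"

end

(* Splitting an up-down word of length 2n at its maximum, which sits at some position 2j+2,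
   leaves an arbitrary up-down word of length 2j+1 on the left, all of whose letters are counted,
   and an up-down word of length 2(n-j-1) on the right, whose statistic is unaffected. Dividing
   the resulting recursion by (2n-1)!! turns the binomial coefficients into falling factorials
   and gives
     p_k(n) - p_k(n-1) = sum over 1 <= j <= k of weight_j(n) p_(k-j)(n-j-1)   for n >= k+2.
   The right-hand side is a polynomial in n by induction on k, hence so is its indefinite sum. *)
theory Submission
  imports Defs "HOL-Combinatorics.Multiset_Permutations"
begin

section \<open>Up-down permutations as words\<close>

fun alternating :: "bool \<Rightarrow> 'a::linorder list \<Rightarrow> bool" where
  "alternating b [] = True"
| "alternating b [x] = True"
| "alternating b (x # y # zs) = ((if b then x < y else y < x) \<and> alternating (\<not> b) (y # zs))"

fun mmp_list :: "'a::linorder list \<Rightarrow> nat" where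
  "mmp_list [] = 0"
| "mmp_list (x # xs) = (if \<exists>y\<in>set xs. x < y then 1 else 0) + mmp_list xs"

text \<open>The alphabet is arbitrary because splitting a word at its maximum produces words over a
  subset and over its complement, not over initial segments.\<close>

definition alt_words :: "'a::linorder set \<Rightarrow> 'a list set" where
  "alt_words S = {xs \<in> permutations_of_set S. alternating True xs}"

text \<open>The flag is negated at every letter, so at index \<open>i\<close> an ascent is required
  exactly when the parity of \<open>i\<close> matches the initial flag.\<close>

lemma alternating_conv_nth:
  "alternating b xs \<longleftrightarrow>
    (\<forall>i. Suc i < length xs \<longrightarrow>
      (if even i = b then xs ! i < xs ! Suc i else xs ! Suc i < xs ! i))"
proof (induction b xs rule: alternating.induct)
  case (3 b x y zs)
  \<comment> \<open>Separating index 0 from the successors mirrors the recursion: index 0 compares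
    \<open>x\<close> with \<open>y\<close>, and the others concern the tail with the negated
    flag.\<close>
  have split: "(\<forall>i. P i) \<longleftrightarrow> P 0 \<and> (\<forall>i. P (Suc i))" for P :: "nat \<Rightarrow> bool"
    by (metis not0_implies_Suc)
  show ?case
    by (subst split) (simp add: 3)
qed auto

lemma mmp_list_conv_card:
  "mmp_list xs = card {i. i < length xs \<and> (\<exists>j<length xs. i < j \<and> xs ! i < xs ! j)}"
proof (induction xs)
  case (Cons x xs)
  let ?I = "{i. i < length xs \<and> (\<exists>j<length xs. i < j \<and> xs ! i < xs ! j)}"
  have "{i. i < length (x # xs) \<and> (\<exists>j<length (x # xs). i < j \<and> (x # xs) ! i < (x # xs) ! j)}
      = (if \<exists>y\<in>set xs. x < y then {0} else {}) \<union> Suc ` ?I" (is "?L = ?R")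
  proof (rule set_eqI)
    fix i
    show "i \<in> ?L \<longleftrightarrow> i \<in> ?R"
    proof (cases i)
      case 0
      have "(\<exists>j<Suc (length xs). 0 < j \<and> x < (x # xs) ! j) \<longleftrightarrow> (\<exists>y\<in>set xs. x < y)"
        by (auto simp: Bex_def in_set_conv_nth Ex_less_Suc2)
      with 0 show ?thesis by auto
    next
      case (Suc i')
      have "(\<exists>j<Suc (length xs). Suc i' < j \<and> xs ! i' < (x # xs) ! j)
          \<longleftrightarrow> (\<exists>j<length xs. i' < j \<and> xs ! i' < xs ! j)"
        by (auto simp: Ex_less_Suc2)
      with Suc show ?thesis by auto
    qed
  qed
  moreover have "card ((if \<exists>y\<in>set xs. x < y then {0} else {}) \<union> Suc ` ?I)
      = (if \<exists>y\<in>set xs. x < y then 1 else 0) + card ?I"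
    by (subst card_Un_disjoint) (auto simp: card_image)
  ultimately show ?case using Cons by simp
qed simp

text \<open>One-line notation. It is injective because a function that permutes {1..n} is the
  identity outside this set, so the listed values determine it.\<close>

lemma bij_betw_permutes_words:
  "bij_betw (\<lambda>\<sigma>. map \<sigma> [1..<Suc n]) {\<sigma>. \<sigma> permutes {1..n}} (permutations_of_set {1..n})"
proof (rule bij_betwI')
  fix \<sigma> \<tau> assume st: "\<sigma> \<in> {\<sigma>. \<sigma> permutes {1..n}}" "\<tau> \<in> {\<sigma>. \<sigma> permutes {1..n}}"
  show "map \<sigma> [1..<Suc n] = map \<tau> [1..<Suc n] \<longleftrightarrow> \<sigma> = \<tau>"
  proof
    assume "map \<sigma> [1..<Suc n] = map \<tau> [1..<Suc n]"
    then have "\<sigma> i = \<tau> i" if "i \<in> {1..n}" for i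
      using that by (simp del: upt_Suc)
    with st show "\<sigma> = \<tau>" by (intro ext) (metis mem_Collect_eq permutes_not_in)
  qed simp
next
  fix \<sigma> assume "\<sigma> \<in> {\<sigma>. \<sigma> permutes {1..n}}"
  then have p: "\<sigma> permutes {1..n}" by simp
  have "{1..<Suc n} = {1..n}" by auto
  then show "map \<sigma> [1..<Suc n] \<in> permutations_of_set {1..n}"
    using permutes_image[OF p] permutes_inj_on[OF p]
    by (simp add: permutations_of_set_def distinct_map del: upt_Suc)
next
  fix xs assume "xs \<in> permutations_of_set {1..n}"
  then have xs: "set xs = {1..n}" "distinct xs" by (auto simp: permutations_of_set_def)
  then have len: "length xs = n" by (metis card_atLeastAtMost diff_Suc_1 distinct_card)
  \<comment> \<open>The preimage reads off the word with indices shifted from base 0 to base 1, and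
    fixes everything outside {1..n} as \<open>permutes\<close> demands.\<close>
  define \<sigma> where "\<sigma> i = (if i \<in> {1..n} then xs ! (i - 1) else i)" for i
  have "\<sigma> permutes {1..n}"
  proof (rule bij_imp_permutes)
    have "bij_betw (\<lambda>i. xs ! i) {..<n} {1..n}"
      using xs len bij_betw_nth by (metis (no_types, lifting))
    moreover have "bij_betw (\<lambda>i. i - 1) {1..n} {..<n}"
      by (rule bij_betw_byWitness[where f' = Suc]) auto
    ultimately have "bij_betw ((\<lambda>i. xs ! i) \<circ> (\<lambda>i. i - 1)) {1..n} {1..n}"
      by (rule bij_betw_trans[rotated])
    then show "bij_betw \<sigma> {1..n} {1..n}"
      by (rule bij_betw_cong[THEN iffD1, rotated]) (simp add: \<sigma>_def)
  qed (auto simp: \<sigma>_def)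
  moreover have "xs = map \<sigma> [1..<Suc n]"
    by (rule nth_equalityI) (auto simp: len \<sigma>_def simp del: upt_Suc)
  ultimately show "\<exists>\<sigma>\<in>{\<sigma>. \<sigma> permutes {1..n}}. xs = map \<sigma> [1..<Suc n]" by blast
qed

text \<open>Odd positions counted from 1 are even indices counted from 0, hence the initial flag
  \<open>True\<close>.\<close>

lemma up_down_iff_alternating:
  "(\<forall>i\<in>{1..<n}. if odd i then \<sigma> i < \<sigma> (Suc i) else \<sigma> i > \<sigma> (Suc i)) \<longleftrightarrow>
    alternating True (map \<sigma> [1..<Suc n])" (is "?L \<longleftrightarrow> ?R")
proof -
  have "?R \<longleftrightarrow> (\<forall>i. Suc i < n \<longrightarrow>
      (if even i then \<sigma> (Suc i) < \<sigma> (Suc (Suc i)) else \<sigma> (Suc i) > \<sigma> (Suc (Suc i))))"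
    unfolding alternating_conv_nth length_map length_upt diff_Suc_1
    by (intro iff_allI imp_cong refl) (simp_all del: upt_Suc)
  also have "\<dots> \<longleftrightarrow> (\<forall>i\<in>Suc ` {..<n - 1}. if odd i then \<sigma> i < \<sigma> (Suc i) else \<sigma> i > \<sigma> (Suc i))"
    unfolding ball_simps(9) by (simp add: Ball_def less_diff_conv)
  also have "Suc ` {..<n - 1} = {1..<n}"
    by (cases n) (simp_all add: lessThan_atLeast0)
  finally show ?thesis by blast
qed

lemma mmp1000_eq_mmp_list: "mmp1000 n \<sigma> = mmp_list (map \<sigma> [1..<Suc n])"
proof -
  have "{i \<in> {1..n}. \<exists>j\<in>{1..n}. i < j \<and> \<sigma> i < \<sigma> j} =
      Suc ` {i. i < n \<and> (\<exists>j<n. i < j \<and> \<sigma> (Suc i) < \<sigma> (Suc j))}"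
  proof (rule set_eqI)
    fix i
    have ex: "(\<exists>j\<in>{1..n}. P j) \<longleftrightarrow> (\<exists>j<n. P (Suc j))" for P
      unfolding image_Suc_lessThan[symmetric] by blast
    show "i \<in> {i \<in> {1..n}. \<exists>j\<in>{1..n}. i < j \<and> \<sigma> i < \<sigma> j} \<longleftrightarrow>
      i \<in> Suc ` {i. i < n \<and> (\<exists>j<n. i < j \<and> \<sigma> (Suc i) < \<sigma> (Suc j))}"
      unfolding ex by (cases i) auto
  qed
  moreover have "{i. i < length (map \<sigma> [1..<Suc n]) \<and> (\<exists>j<length (map \<sigma> [1..<Suc n]).
        i < j \<and> map \<sigma> [1..<Suc n] ! i < map \<sigma> [1..<Suc n] ! j)}
      = {i. i < n \<and> (\<exists>j<n. i < j \<and> \<sigma> (Suc i) < \<sigma> (Suc j))}"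
    by (simp cong: conj_cong del: upt_Suc)
  ultimately show ?thesis
    by (simp add: mmp1000_def mmp_list_conv_card card_image del: upt_Suc)
qed

lemma bij_betw_up_down_perms:
  "bij_betw (\<lambda>\<sigma>. map \<sigma> [1..<Suc n]) (up_down_perms n) (alt_words {1..n})"
proof (rule bij_betw_subset[OF bij_betw_permutes_words])
  show "up_down_perms n \<subseteq> {\<sigma>. \<sigma> permutes {1..n}}"
    unfolding up_down_perms_def by blast
  show "(\<lambda>\<sigma>. map \<sigma> [1..<Suc n]) ` up_down_perms n = alt_words {1..n}"
    unfolding alt_words_def bij_betw_imp_surj_on[OF bij_betw_permutes_words, symmetric]
      Compr_image_eq up_down_perms_def up_down_iff_alternating by (simp only: mem_Collect_eq)
qed

lemma B_at_1_eq_card_words: "B_at_1 n = card (alt_words {1..n})"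
  unfolding B_at_1_def by (rule bij_betw_same_card[OF bij_betw_up_down_perms])

lemma A_eq_card_words: "A n m = card {xs \<in> alt_words {1..n}. mmp_list xs = m}"
proof -
  let ?f = "\<lambda>\<sigma>. map \<sigma> [1..<Suc n]"
  have "?f ` {\<sigma> \<in> up_down_perms n. mmp1000 n \<sigma> = m} = {xs \<in> alt_words {1..n}. mmp_list xs = m}"
    unfolding bij_betw_imp_surj_on[OF bij_betw_up_down_perms, symmetric] Compr_image_eq
      mmp1000_eq_mmp_list by (rule refl)
  moreover have "inj_on ?f {\<sigma> \<in> up_down_perms n. mmp1000 n \<sigma> = m}"
    using bij_betw_imp_inj_on[OF bij_betw_up_down_perms, of n]
    by (rule inj_on_subset) blast
  ultimately have "bij_betw ?f {\<sigma> \<in> up_down_perms n. mmp1000 n \<sigma> = m} {xs \<in> alt_words {1..n}. mmp_list xs = m}"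
    by (simp only: bij_betw_def simp_thms)
  then show ?thesis
    unfolding A_def by (rule bij_betw_same_card)
qed

section \<open>Invariance under order-preserving relabelling\<close>

lemma alternating_map:
  "strict_mono_on (set xs) f \<Longrightarrow> alternating b (map f xs) = alternating b xs"
proof (induction b xs rule: alternating.induct)
  case (3 b x y zs)
  then have "strict_mono_on (set (y # zs)) f" by (auto intro: monotone_on_subset)
  moreover have "f x < f y \<longleftrightarrow> x < y" "f y < f x \<longleftrightarrow> y < x"
    using 3(2) by (auto simp: strict_mono_on_less)
  ultimately show ?case using 3(1) by simp
qed simp_all

lemma mmp_list_map: "strict_mono_on (set xs) f \<Longrightarrow> mmp_list (map f xs) = mmp_list xs"
proof (induction xs)
  case (Cons x xs)
  then have "strict_mono_on (set xs) f" by (auto simp: strict_mono_on_def)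
  moreover have "f x < f y \<longleftrightarrow> x < y" if "y \<in> set xs" for y
    using that Cons.prems by (auto simp: strict_mono_on_less)
  ultimately show ?case using Cons.IH by auto
qed simp

lemma finite_alt_words [simp]: "finite (alt_words S)"
  unfolding alt_words_def by simp

lemma alt_words_image:
  assumes "strict_mono_on S f"
  shows "alt_words (f ` S) = map f ` alt_words S"
proof -
  have "alternating b (map f xs) = alternating b xs" if "xs \<in> permutations_of_set S" for b xs
    using that assms by (intro alternating_map) (simp add: permutations_of_set_def)
  moreover have "permutations_of_set (f ` S) = map f ` permutations_of_set S"
    using assms by (simp add: permutations_of_set_image_inj strict_mono_on_imp_inj_on)
  ultimately show ?thesis
    unfolding alt_words_def by auto
qed

lemma inj_on_map_alt_words:
  assumes "inj_on f S"
  shows "inj_on (map f) (alt_words S)"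
  by (rule inj_onI)
    (use assms in \<open>auto simp: alt_words_def permutations_of_set_def intro: map_inj_on\<close>)

text \<open>The increasing enumeration of \<open>S\<close> carries words over {1..card S} to words
  over \<open>S\<close>, which makes all later counts depend on the cardinality alone.\<close>

lemma ex_strict_mono_image:
  assumes "finite (S :: nat set)"
  obtains f where "strict_mono_on {1..card S} f" "f ` {1..card S} = S"
proof
  let ?xs = "sorted_list_of_set S"
  let ?f = "\<lambda>i. ?xs ! (i - 1)"
  have len: "length ?xs = card S" using assms by simp
  show "strict_mono_on {1..card S} ?f"
    using strict_sorted_list_of_set[of S] len
    by (auto simp: strict_mono_on_def sorted_wrt_iff_nth_less)
  have "(\<lambda>i. i - 1) ` {1..card S} = {..<card S}"
    by (force simp: image_iff intro: bexI[of _ "Suc _"])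
  then have "?f ` {1..card S} = (!) ?xs ` {..<card S}"
    by (metis image_image)
  also have "\<dots> = set ?xs" using len by (simp add: nth_image lessThan_atLeast0)
  finally show "?f ` {1..card S} = S" using assms by simp
qed

lemma card_alt_words:
  assumes "finite (S :: nat set)"
  shows "card (alt_words S) = B_at_1 (card S)"
proof -
  obtain f where f: "strict_mono_on {1..card S} f" "f ` {1..card S} = S"
    using ex_strict_mono_image[OF assms] .
  then show ?thesis
    using alt_words_image[OF f(1)] inj_on_map_alt_words[OF strict_mono_on_imp_inj_on[OF f(1)]]
    by (simp add: card_image B_at_1_eq_card_words)
qed

lemma card_alt_words_mmp:
  assumes "finite (S :: nat set)"
  shows "card {xs \<in> alt_words S. mmp_list xs = m} = A (card S) m"
proof -
  obtain f where f: "strict_mono_on {1..card S} f" "f ` {1..card S} = S"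
    using ex_strict_mono_image[OF assms] .
  let ?W = "alt_words {1..card S}"
  have "mmp_list (map f xs) = mmp_list xs" if "xs \<in> ?W" for xs
    using that f(1) by (intro mmp_list_map) (simp add: alt_words_def permutations_of_set_def)
  then have "{xs \<in> alt_words S. mmp_list xs = m} = map f ` {xs \<in> ?W. mmp_list xs = m}"
    using alt_words_image[OF f(1)] f(2) by auto
  moreover have "inj_on (map f) {xs \<in> ?W. mmp_list xs = m}"
    by (rule inj_on_subset[OF inj_on_map_alt_words[OF strict_mono_on_imp_inj_on[OF f(1)]]]) auto
  ultimately show ?thesis by (simp add: card_image A_eq_card_words)
qed

section \<open>Splitting a word at its greatest letter\<close>

lemma alternating_append_Cons:
  "alternating b (ys @ x # zs) \<longleftrightarrow>
    alternating b (ys @ [x]) \<and> alternating (if even (length ys) then b else \<not> b) (x # zs)"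
  by (induction b ys rule: alternating.induct) (cases zs; auto)+

text \<open>The greatest letter can only be reached by an ascent. The step into the last position
  has index \<open>length ys - 1\<close>, whose parity must match \<open>b\<close>.\<close>

lemma alternating_snoc_greatest:
  assumes "\<forall>y\<in>set ys. y < x"
  shows "alternating b (ys @ [x]) \<longleftrightarrow> alternating b ys \<and> (ys = [] \<or> odd (length ys) = b)"
  using assms by (induction b ys rule: alternating.induct) auto

text \<open>Each letter before \<open>x\<close> is counted because of \<open>x\<close>, while
  \<open>x\<close> is not. Letters after \<open>x\<close> are judged only by what follows
  them.\<close>

lemma mmp_list_append_greatest:
  assumes "\<forall>y\<in>set ys. y < x" "\<forall>z\<in>set zs. z < x"
  shows "mmp_list (ys @ x # zs) = length ys + mmp_list zs"
  using assms by (induction ys) (auto dest: less_asym)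

text \<open>The greatest letter must be a peak, so the word to its left has odd length; the word to
  its right then starts with an ascent again.\<close>

lemma alternating_split_greatest:
  assumes "\<forall>y\<in>set ys. y < x" "\<forall>z\<in>set zs. z < x" "odd (length ys + length zs)"
  shows "alternating True (ys @ x # zs) \<longleftrightarrow>
    odd (length ys) \<and> alternating True ys \<and> alternating True zs"
proof (cases "odd (length ys)")
  case True
  have "alternating False (x # zs) \<longleftrightarrow> alternating True zs"
    using assms(2) by (cases zs) auto
  then show ?thesis
    using True by (auto simp: alternating_append_Cons[of _ ys x zs] alternating_snoc_greatest[OF assms(1)])
next
  case False
  \<comment> \<open>If \<open>ys\<close> has even length, parity makes \<open>zs\<close> nonempty,
    and the pattern demands an ascent from \<open>x\<close> into \<open>zs\<close>, which is
    impossible.\<close>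
  then obtain z zs' where "zs = z # zs'" using assms(3) by (cases zs) auto
  then show ?thesis
    using False assms(2) by (subst alternating_append_Cons) auto
qed

text \<open>\<open>T\<close> is the set of letters to the left of \<open>x\<close>. The bound
  \<open>card T \<le> m\<close> guards the truncated subtraction \<open>m - card T\<close>, which
  would otherwise admit words with too large a statistic.\<close>

lemma alt_words_split_greatest:
  assumes "finite (S :: nat set)" "odd (card S)" "\<forall>y\<in>S. y < x"
  shows "{xs \<in> alt_words (insert x S). mmp_list xs = m} =
    (\<Union>T\<in>{T. T \<subseteq> S \<and> odd (card T) \<and> card T \<le> m}.
      (\<lambda>(ys, zs). ys @ x # zs) `
        (alt_words T \<times> {zs \<in> alt_words (S - T). mmp_list zs = m - card T}))"
    (is "?L = ?R")
proof (intro equalityI subsetI)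
  fix xs assume "xs \<in> ?L"
  then have xs: "set xs = insert x S" "distinct xs" "alternating True xs" "mmp_list xs = m"
    by (auto simp: alt_words_def permutations_of_set_def)
  then obtain ys zs where eq: "xs = ys @ x # zs" by (metis insertI1 split_list)
  with xs assms(3) have S: "S = set ys \<union> set zs" and disj: "set ys \<inter> set zs = {}"
    by (auto simp: insert_eq_iff)
  have d: "distinct ys" "distinct zs" using xs eq by auto
  have sub: "S - set ys = set zs" using S disj by auto
  have less: "\<forall>y\<in>set ys. y < x" "\<forall>z\<in>set zs. z < x" using S assms(3) by auto
  have "card S = length ys + length zs"
    using S disj d by (simp add: card_Un_disjoint distinct_card)
  then have odd: "odd (length ys + length zs)" using assms(2) by simp
  have alt: "odd (length ys)" "alternating True ys" "alternating True zs"
    using xs(3) alternating_split_greatest[OF less odd] eq by auto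
  have "m = length ys + mmp_list zs"
    using mmp_list_append_greatest[OF less] xs(4) eq by simp
  then show "xs \<in> ?R"
    using S d sub alt eq
    by (intro UN_I[of "set ys"] image_eqI[of _ _ "(ys, zs)"])
       (auto simp: alt_words_def permutations_of_set_def distinct_card)
next
  fix xs assume "xs \<in> ?R"
  then obtain T ys zs where T: "T \<subseteq> S" "odd (card T)" "card T \<le> m" and eq: "xs = ys @ x # zs"
    and ys: "ys \<in> alt_words T" and zs: "zs \<in> alt_words (S - T)" "mmp_list zs = m - card T"
    by auto
  have y: "set ys = T" "distinct ys" "alternating True ys"
    and z: "set zs = S - T" "distinct zs" "alternating True zs"
    using ys zs by (auto simp: alt_words_def permutations_of_set_def)
  have less: "\<forall>y\<in>set ys. y < x" "\<forall>z\<in>set zs. z < x" using y z T assms(3) by auto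
  have len: "length ys = card T" "length zs = card (S - T)"
    using y z by (metis distinct_card)+
  have "card T + card (S - T) = card S"
    using T assms(1) by (metis card_Diff_subset card_mono finite_subset le_add_diff_inverse)
  then have odd: "odd (length ys + length zs)" using len assms(2) by simp
  have "alternating True xs"
    using alternating_split_greatest[OF less odd] y z T len eq by auto
  moreover have "mmp_list xs = m"
    using mmp_list_append_greatest[OF less] zs(2) T len eq by simp
  moreover have "set xs = insert x S" "distinct xs"
    using eq y z T less by auto
  ultimately show "xs \<in> ?L"
    by (auto simp: alt_words_def permutations_of_set_def)
qed

text \<open>Both decompositions cut at the first occurrence of \<open>x\<close>.\<close>

lemma append_Cons_cancel:
  assumes "ys @ x # zs = ys' @ x # zs'" "x \<notin> set ys" "x \<notin> set ys'"
  shows "ys = ys'" "zs = zs'"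
  using assms by (auto simp: append_eq_append_conv2 Cons_eq_append_conv append_eq_Cons_conv)

section \<open>The recursion for \<open>A\<close>\<close>

lemma A_rec_sets:
  assumes "odd N"
  shows "A (Suc N) m = (\<Sum>T | T \<subseteq> {1..N} \<and> odd (card T) \<and> card T \<le> m.
    B_at_1 (card T) * A (N - card T) (m - card T))"
proof -
  let ?I = "{T. T \<subseteq> {1..N} \<and> odd (card T) \<and> card T \<le> m}"
  let ?P = "\<lambda>T. alt_words T \<times> {zs \<in> alt_words ({1..N} - T). mmp_list zs = m - card T}"
  let ?f = "\<lambda>(ys, zs). ys @ Suc N # zs"
  have notin: "Suc N \<notin> set ys" if "ys \<in> alt_words T" "T \<subseteq> {1..N}" for ys T
    using that by (auto simp: alt_words_def permutations_of_set_def)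
  have "A (Suc N) m = card {xs \<in> alt_words {1..Suc N}. mmp_list xs = m}"
    by (rule A_eq_card_words)
  also have "{1..Suc N} = insert (Suc N) {1..N}" by auto
  also have "{xs \<in> alt_words (insert (Suc N) {1..N}). mmp_list xs = m} = (\<Union>T\<in>?I. ?f ` ?P T)"
    by (rule alt_words_split_greatest) (use assms in auto)
  also have "card (\<Union>T\<in>?I. ?f ` ?P T) = (\<Sum>T\<in>?I. card (?f ` ?P T))"
  proof (rule card_UN_disjoint)
    have "?I \<subseteq> Pow {1..N}" by auto
    then show "finite ?I" by (rule finite_subset) simp
    show "\<forall>T\<in>?I. finite (?f ` ?P T)" by auto
    \<comment> \<open>The word determines the part before \<open>Suc N\<close>, and thereby its set
      of letters \<open>T\<close>, so different sets give disjoint families.\<close>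
    show "\<forall>T\<in>?I. \<forall>U\<in>?I. T \<noteq> U \<longrightarrow> ?f ` ?P T \<inter> ?f ` ?P U = {}"
    proof (intro ballI impI, rule ccontr)
      fix T U assume TU: "T \<in> ?I" "U \<in> ?I" "T \<noteq> U" and "?f ` ?P T \<inter> ?f ` ?P U \<noteq> {}"
      then obtain xs where "xs \<in> ?f ` ?P T" "xs \<in> ?f ` ?P U" by blast
      then obtain ys zs ys' zs' where w: "ys \<in> alt_words T" "ys' \<in> alt_words U"
        "ys @ Suc N # zs = ys' @ Suc N # zs'" by (elim imageE) (clarsimp, metis)
      have "ys = ys'"
        by (rule append_Cons_cancel(1)[OF w(3) notin[OF w(1)] notin[OF w(2)]]) (use TU in simp_all)
      with w TU(3) show False by (simp add: alt_words_def permutations_of_set_def)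
    qed
  qed
  also have "\<dots> = (\<Sum>T\<in>?I. B_at_1 (card T) * A (N - card T) (m - card T))"
  proof (rule sum.cong[OF refl])
    fix T assume "T \<in> ?I"
    then have T: "T \<subseteq> {1..N}" by simp
    then have fin: "finite T" by (rule finite_subset) simp
    have "inj_on ?f (?P T)"
    proof (rule inj_onI, clarify)
      fix ys zs ys' zs' assume "ys \<in> alt_words T" "ys' \<in> alt_words T"
        and eq: "ys @ Suc N # zs = ys' @ Suc N # zs'"
      then have "Suc N \<notin> set ys" "Suc N \<notin> set ys'" using notin T by blast+
      then show "ys = ys' \<and> zs = zs'" using append_Cons_cancel[OF eq] by blast
    qed
    then have "card (?f ` ?P T) = card (?P T)" by (rule card_image)
    also have "\<dots> = B_at_1 (card T) * A (card ({1..N} - T)) (m - card T)"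
      using fin by (simp add: card_cartesian_product card_alt_words card_alt_words_mmp)
    also have "card ({1..N} - T) = N - card T" using T fin by (simp add: card_Diff_subset)
    finally show "card (?f ` ?P T) = B_at_1 (card T) * A (N - card T) (m - card T)" .
  qed
  finally show ?thesis .
qed

lemma A_rec:
  "A (2 * Suc n) m = (\<Sum>j\<le>n. if 2 * j + 1 \<le> m
    then ((2 * n + 1) choose (2 * j + 1)) * B_at_1 (2 * j + 1) * A (2 * (n - j)) (m - (2 * j + 1))
    else 0)"
proof -
  let ?N = "2 * n + 1"
  let ?g = "\<lambda>c. B_at_1 c * A (?N - c) (m - c)"
  let ?I = "{T. T \<subseteq> {1..?N} \<and> odd (card T) \<and> card T \<le> m}"
  let ?J = "{j. j \<le> n \<and> 2 * j + 1 \<le> m}"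
  have fin: "finite ?I"
    by (rule finite_subset[of _ "Pow {1..?N}"]) auto
  have "A (2 * Suc n) m = (\<Sum>T\<in>?I. ?g (card T))"
    using A_rec_sets[of ?N m] by simp
  \<comment> \<open>The summand depends only on \<open>card T\<close>, so the sets are grouped by
    the \<open>j\<close> with \<open>card T = 2 * j + 1\<close>; a binomial coefficient counts each
    group.\<close>
  also have "\<dots> = (\<Sum>j\<in>?J. \<Sum>T | T \<in> ?I \<and> (card T - 1) div 2 = j. ?g (card T))"
  proof (rule sum.group[symmetric, OF fin])
    show "(\<lambda>T. (card T - 1) div 2) ` ?I \<subseteq> ?J"
    proof (intro subsetI, elim imageE)
      fix j T assume j: "j = (card T - 1) div 2" and T: "T \<in> ?I"
      then have "card T \<le> ?N" using card_mono[of "{1..?N}" T] by simp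
      moreover from T obtain i where "card T = 2 * i + 1" by (auto elim: oddE)
      ultimately show "j \<in> ?J" using j T by auto
    qed
  qed simp
  also have "\<dots> = (\<Sum>j\<in>?J. (?N choose (2 * j + 1)) * ?g (2 * j + 1))"
  proof (rule sum.cong[OF refl])
    fix j assume j: "j \<in> ?J"
    have c: "odd c \<and> c \<le> m \<and> (c - 1) div 2 = j \<longleftrightarrow> c = 2 * j + 1" for c
      using j by (auto elim: oddE)
    have "{T. T \<in> ?I \<and> (card T - 1) div 2 = j} = {T. T \<subseteq> {1..?N} \<and> card T = 2 * j + 1}"
      using c by blast
    then show "(\<Sum>T | T \<in> ?I \<and> (card T - 1) div 2 = j. ?g (card T)) = (?N choose (2 * j + 1)) * ?g (2 * j + 1)"
      using n_subsets[of "{1..?N}" "2 * j + 1"] by simp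
  qed
  also have "\<dots> = (\<Sum>j\<in>?J. (?N choose (2 * j + 1)) * B_at_1 (2 * j + 1) * A (2 * (n - j)) (m - (2 * j + 1)))"
    by (rule sum.cong) (auto simp: algebra_simps diff_mult_distrib2)
  also have "\<dots> = (\<Sum>j\<le>n. if 2 * j + 1 \<le> m
    then (?N choose (2 * j + 1)) * B_at_1 (2 * j + 1) * A (2 * (n - j)) (m - (2 * j + 1)) else 0)"
    by (rule sum.mono_neutral_cong_left) auto
  finally show ?thesis .
qed

section \<open>Initial values and vanishing range\<close>

lemma A_0: "A 0 m = (if m = 0 then 1 else 0)"
proof -
  have "{xs \<in> alt_words {1..0::nat}. mmp_list xs = m} = (if m = 0 then {[]} else {})"
    by (auto simp: alt_words_def)
  then show ?thesis by (simp add: A_eq_card_words)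
qed

lemma B_at_1_1: "B_at_1 1 = 1"
proof -
  have "alt_words {1..1::nat} = {[1]}" by (auto simp: alt_words_def permutations_of_set_singleton)
  then show ?thesis by (simp add: B_at_1_eq_card_words)
qed

text \<open>All \<open>n\<close> letters at odd positions precede a larger one. In the recursion, a
  term lowers the statistic by 2j+1 but the half-length by only j+1, so the strict inequality
  persists.\<close>

lemma A_eq_0_low: "m < n \<Longrightarrow> A (2 * n) m = 0"
proof (induction n arbitrary: m rule: less_induct)
  case (less n)
  then obtain n' where n: "n = Suc n'" by (cases n) auto
  show ?case unfolding n A_rec
    by (rule sum.neutral) (use less n in auto)
qed

text \<open>The maximum of a nonempty word is never counted. Positivity of \<open>m\<close> excludes
  the empty word, which has statistic 0.\<close>

lemma A_eq_0_high: "2 * n \<le> m \<Longrightarrow> 0 < m \<Longrightarrow> A (2 * n) m = 0"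
proof (induction n arbitrary: m rule: less_induct)
  case (less n)
  show ?case
  proof (cases n)
    case 0
    then show ?thesis using less by (simp add: A_0)
  next
    case (Suc n')
    show ?thesis unfolding Suc A_rec
      by (rule sum.neutral) (use less Suc in auto)
  qed
qed

text \<open>This is the largest possible statistic, so only the maximum is uncounted and it stands
  last: the terms with j < k vanish by \<open>A_eq_0_high\<close>.\<close>

lemma A_base: "A (2 * Suc k) (Suc k + k) = B_at_1 (2 * k + 1)"
proof -
  have "A (2 * Suc k) (Suc k + k) = (\<Sum>j\<le>k. if j = k then B_at_1 (2 * k + 1) else 0)"
    unfolding A_rec by (rule sum.cong) (auto simp: A_0 A_eq_0_high)
  then show ?thesis by simp
qed

text \<open>The excess of the statistic over the half-length drops from \<open>k\<close> to
  \<open>k - j\<close>. For j > k it would become negative, and such terms vanish by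
  \<open>A_eq_0_low\<close>.\<close>

lemma A_step:
  assumes "k \<le> n"
  shows "A (2 * Suc n) (Suc n + k) = (\<Sum>j\<le>k. ((2 * n + 1) choose (2 * j + 1)) *
    B_at_1 (2 * j + 1) * A (2 * (n - j)) ((n - j) + (k - j)))"
  unfolding A_rec
proof (rule sum.mono_neutral_cong_right)
  fix j assume "j \<in> {..k}"
  then show "(if 2 * j + 1 \<le> Suc n + k then ((2 * n + 1) choose (2 * j + 1)) * B_at_1 (2 * j + 1)
      * A (2 * (n - j)) (Suc n + k - (2 * j + 1)) else 0)
    = ((2 * n + 1) choose (2 * j + 1)) * B_at_1 (2 * j + 1) * A (2 * (n - j)) ((n - j) + (k - j))"
    using assms by (auto simp: mult_2 intro!: arg_cong2[of _ _ _ _ A])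
qed (use assms in \<open>auto intro!: A_eq_0_low\<close>)

section \<open>Double factorials against binomial coefficients\<close>

lemma odd_double_fact_pos: "odd_double_fact n > 0"
  unfolding odd_double_fact_def by (rule prod_pos) auto

lemma odd_double_fact_Suc: "odd_double_fact (Suc n) = (2 * n + 1) * odd_double_fact n"
  by (simp add: odd_double_fact_def)

text \<open>With r = n-j-1, passing from j to j+1 multiplies the binomial by (2r+2)(2r+1) /
  ((2j+3)(2j+2)). The double factorial absorbs 2r+1, the factorial absorbs the denominator, and 2r+2
  supplies one factor 2 and the new falling factor n-j.\<close>

lemma choose_odd_double_fact:
  assumes "j \<le> n"
  shows "real ((2 * n + 1) choose (2 * j + 1)) * real (odd_double_fact (n - j)) =
    2 ^ j * falling (real n) j / fact (2 * j + 1) * real (odd_double_fact (Suc n))"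
  using assms
proof (induction j)
  case 0
  then show ?case by (simp add: falling_def odd_double_fact_Suc algebra_simps)
next
  case (Suc j)
  define a b where "a = 2 * n + 1" and "b = 2 * j + 1"
  obtain r where r: "n - j = Suc r" using Suc.prems by (metis Suc_diff_Suc Suc_le_lessD)
  then have n: "n = j + Suc r" and r': "n - Suc j = r" by simp_all
  \<comment> \<open>The quotient of (2j+3)! by (2j+1)!.\<close>
  define u where "u = (2 * real j + 3) * (2 * real j + 2)"
  have u: "u \<noteq> 0" unfolding u_def by (simp add: add_nonneg_eq_0_iff)
  have step: "real (a choose Suc c) * real (Suc c) = real (a choose c) * real (a - c)" for c
  proof -
    have "(a choose Suc c) * Suc c = (a choose c) * (a - c)"
      using binomial_absorption[of c a] binomial_absorb_comp[of a c] by (simp only: mult.commute)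
    then show ?thesis by (simp only: of_nat_mult[symmetric])
  qed
  have s1: "real (a choose Suc b) * (2 * real j + 2) = real (a choose b) * (2 * real r + 2)"
    using step[of b] by (simp add: a_def b_def n add_ac)
  have s2: "real (a choose Suc (Suc b)) * (2 * real j + 3) = real (a choose Suc b) * (2 * real r + 1)"
    using step[of "Suc b"] by (simp add: a_def b_def n add_ac)
  have "real (a choose Suc (Suc b)) * u =
      real (a choose Suc (Suc b)) * (2 * real j + 3) * (2 * real j + 2)"
    by (simp only: u_def mult.assoc)
  also have "\<dots> = real (a choose Suc b) * (2 * real j + 2) * (2 * real r + 1)"
    unfolding s2 by (simp only: mult_ac)
  also have "\<dots> = real (a choose b) * (2 * real r + 2) * (2 * real r + 1)"
    unfolding s1 ..
  finally have C: "real (a choose Suc (Suc b)) * u =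
      real (a choose b) * (2 * real r + 2) * (2 * real r + 1)" .
  have odd_Suc: "real (odd_double_fact (Suc r)) = (2 * real r + 1) * real (odd_double_fact r)"
    by (simp add: odd_double_fact_Suc algebra_simps)
  have IH: "real (a choose b) * ((2 * real r + 1) * real (odd_double_fact r)) =
      2 ^ j * falling (real n) j / fact b * real (odd_double_fact (Suc n))"
    using Suc.IH Suc.prems unfolding r odd_Suc a_def b_def by linarith
  have fall: "falling (real n) (Suc j) = falling (real n) j * (real r + 1)"
    by (simp add: falling_def n)
  have f: "fact (Suc (Suc b)) = u * (fact b :: real)"
    by (simp add: b_def u_def algebra_simps)
  have "real (a choose Suc (Suc b)) * real (odd_double_fact r) * u =
     (2 * real r + 2) * (real (a choose b) * ((2 * real r + 1) * real (odd_double_fact r)))"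
    using arg_cong[OF C, of "\<lambda>x. x * real (odd_double_fact r)"] by (simp only: mult_ac)
  also have "\<dots> = (2 * real r + 2) * (2 ^ j * falling (real n) j / fact b * real (odd_double_fact (Suc n)))"
    unfolding IH ..
  also have "\<dots> = 2 ^ Suc j * falling (real n) (Suc j) / fact (Suc (Suc b)) * real (odd_double_fact (Suc n)) * u"
    unfolding fall f using u by (simp add: field_simps)
  finally have "real (a choose Suc (Suc b)) * real (odd_double_fact r) =
      2 ^ Suc j * falling (real n) (Suc j) / fact (Suc (Suc b)) * real (odd_double_fact (Suc n))"
    by (rule mult_right_cancel[OF u, THEN iffD1])
  moreover have "2 * Suc j + 1 = Suc (Suc b)" by (simp add: b_def)
  ultimately show ?case by (simp only: r' a_def)
qed

section \<open>Normalisation by (2n-1)!!, giving the prospective values of p_k(n)\<close>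

definition ratio :: "nat \<Rightarrow> nat \<Rightarrow> real" where
  "ratio k n = real (A (2 * n) (n + k)) / real (odd_double_fact n)"

text \<open>The coefficient in the claimed recursion. The argument \<open>t\<close> is real so that
  it can be recognised as a polynomial in \<open>t\<close>.\<close>

definition weight :: "nat \<Rightarrow> real \<Rightarrow> real" where
  "weight j t = real (B_at_1 (2 * j + 1)) * 2 ^ j * falling (t - 1) j / fact (2 * j + 1)"

lemma ratio_base: "ratio k (k + 1) = real (B_at_1 (2 * k + 1)) / real (odd_double_fact (k + 1))"
  using A_base[of k] by (simp add: ratio_def)

lemma ratio_step:
  assumes "k \<le> n"
  shows "ratio k (Suc n) = ratio k n + (\<Sum>j=1..k. weight j (real (Suc n)) * ratio (k - j) (n - j))"
proof -
  let ?d = "real (odd_double_fact (Suc n))"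
  have d: "?d \<noteq> 0" using odd_double_fact_pos[of "Suc n"] by simp
  have "real (A (2 * Suc n) (Suc n + k)) = (\<Sum>j\<le>k. real ((2 * n + 1) choose (2 * j + 1)) *
    real (B_at_1 (2 * j + 1)) * real (A (2 * (n - j)) ((n - j) + (k - j))))"
    unfolding A_step[OF assms] by simp
  also have "\<dots> = (\<Sum>j\<le>k. weight j (real (Suc n)) * ratio (k - j) (n - j) * ?d)"
  proof (rule sum.cong[OF refl])
    fix j assume "j \<in> {..k}"
    then have j: "j \<le> n" using assms by simp
    have A: "real (A (2 * (n - j)) ((n - j) + (k - j))) = ratio (k - j) (n - j) * real (odd_double_fact (n - j))"
      using odd_double_fact_pos[of "n - j"] by (simp add: ratio_def)
    have "real ((2 * n + 1) choose (2 * j + 1)) * real (B_at_1 (2 * j + 1)) * real (A (2 * (n - j)) ((n - j) + (k - j)))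
      = real (B_at_1 (2 * j + 1)) * ratio (k - j) (n - j) *
        (real ((2 * n + 1) choose (2 * j + 1)) * real (odd_double_fact (n - j)))"
      unfolding A by (simp only: mult_ac)
    also have "\<dots> = weight j (real (Suc n)) * ratio (k - j) (n - j) * ?d"
      unfolding choose_odd_double_fact[OF j] weight_def by simp
    finally show "real ((2 * n + 1) choose (2 * j + 1)) * real (B_at_1 (2 * j + 1)) *
        real (A (2 * (n - j)) ((n - j) + (k - j))) = weight j (real (Suc n)) * ratio (k - j) (n - j) * ?d" .
  qed
  also have "\<dots> = (\<Sum>j\<le>k. weight j (real (Suc n)) * ratio (k - j) (n - j)) * ?d"
    by (rule sum_distrib_right[symmetric])
  finally have "ratio k (Suc n) = (\<Sum>j\<le>k. weight j (real (Suc n)) * ratio (k - j) (n - j))"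
    unfolding ratio_def[of k "Suc n"] using d by (simp only: nonzero_mult_div_cancel_right not_False_eq_True)
  \<comment> \<open>The term j = 0 is \<open>ratio k n\<close> itself, since its weight is B_1(1) =
    1. Splitting it off leaves a difference equation whose right-hand side involves only smaller
    indices k-j.\<close>
  also have "\<dots> = weight 0 (real (Suc n)) * ratio k n + (\<Sum>j=1..k. weight j (real (Suc n)) * ratio (k - j) (n - j))"
    by (simp add: sum.atMost_shift sum.atLeast1_atMost_eq lessThan_Suc_atMost)
  also have "weight 0 (real (Suc n)) = 1"
    using B_at_1_1 by (simp add: weight_def falling_def)
  finally show ?thesis by simp
qed

text \<open>Telescoping \<open>ratio_step\<close> from the initial value at n = k+1; the first
  increment leads to k+2, where the sum over \<open>t\<close> begins.\<close>

lemma ratio_sum: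
  assumes "n \<ge> k + 1"
  shows "ratio k n = real (B_at_1 (2 * k + 1)) / real (odd_double_fact (k + 1)) +
    (\<Sum>j=1..k. \<Sum>t=k+2..n. weight j (real t) * ratio (k - j) (t - j - 1))"
  using assms
proof (induction n rule: dec_induct)
  case base
  show ?case using ratio_base[of k] by simp
next
  case (step n)
  have "(\<Sum>j=1..k. \<Sum>t=k+2..Suc n. weight j (real t) * ratio (k - j) (t - j - 1)) =
      (\<Sum>j=1..k. \<Sum>t=k+2..n. weight j (real t) * ratio (k - j) (t - j - 1)) +
      (\<Sum>j=1..k. weight j (real (Suc n)) * ratio (k - j) (n - j))"
    unfolding sum.distrib[symmetric] using step by (intro sum.cong) auto
  then show ?case using step ratio_step[of k n] by simp
qed

section \<open>Indefinite summation of polynomials\<close>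

lemma backward_difference_monom:
  "\<exists>q :: real poly. \<forall>x. poly q x - poly q (x - 1) = x ^ d"
proof (induction d rule: less_induct)
  case (less d)
  \<comment> \<open>Placing \<open>i < d\<close> inside the existential lets one total function
    \<open>q\<close> choose all the lower antidifferences.\<close>
  then have "\<forall>i. \<exists>q :: real poly. i < d \<longrightarrow> (\<forall>x. poly q x - poly q (x - 1) = x ^ i)" by blast
  then obtain q :: "nat \<Rightarrow> real poly"
    where q: "\<And>i x. i < d \<Longrightarrow> poly (q i) x - poly (q i) (x - 1) = x ^ i" by metis
  \<comment> \<open>The coefficients of (x-1)^(d+1). Those of index below d are the error by which
    the difference of x^(d+1) misses (d+1) x^d; adding the known antidifferences of these terms
    cancels it, and division by d+1 normalises.\<close>
  define c :: "nat \<Rightarrow> real" where "c i = real (Suc d choose i) * (-1) ^ (Suc d - i)" for i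
  define r where "r = smult (1 / real (Suc d)) (monom 1 (Suc d) + (\<Sum>i<d. smult (c i) (q i)))"
  have "poly r x - poly r (x - 1) = x ^ d" for x
  proof -
    have "(x - 1) ^ Suc d = (\<Sum>i\<le>Suc d. c i * x ^ i)"
      using binomial_ring[of x "-1" "Suc d"] by (simp add: c_def mult_ac del: power_Suc sum.atMost_Suc binomial_Suc_Suc)
    also have "\<dots> = (\<Sum>i<d. c i * x ^ i) - real (Suc d) * x ^ d + x ^ Suc d"
      by (simp add: c_def lessThan_Suc_atMost[symmetric] del: binomial_Suc_Suc power_Suc of_nat_Suc)
    finally have 1: "x ^ Suc d - (x - 1) ^ Suc d = real (Suc d) * x ^ d - (\<Sum>i<d. c i * x ^ i)"
      by simp
    have "(\<Sum>i<d. c i * poly (q i) x) - (\<Sum>i<d. c i * poly (q i) (x - 1)) = (\<Sum>i<d. c i * x ^ i)"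
      unfolding sum_subtractf[symmetric] right_diff_distrib[symmetric] by (simp add: q)
    with 1 have "real (Suc d) * (poly r x - poly r (x - 1)) = real (Suc d) * x ^ d"
      by (simp add: r_def poly_monom poly_sum right_diff_distrib del: power_Suc of_nat_Suc)
    then show ?thesis by (simp del: of_nat_Suc)
  qed
  then show ?case by blast
qed

lemma backward_difference_poly:
  "\<exists>q. \<forall>x :: real. poly q x - poly q (x - 1) = poly p x"
proof -
  obtain q :: "nat \<Rightarrow> real poly" where q: "\<And>d x. poly (q d) x - poly (q d) (x - 1) = x ^ d"
    using backward_difference_monom by metis
  let ?r = "\<Sum>i\<le>degree p. smult (coeff p i) (q i)"
  have "poly ?r x - poly ?r (x - 1) = poly p x" for x
    by (simp add: poly_sum sum_subtractf[symmetric] right_diff_distrib[symmetric] q poly_altdef[of p])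
  then show ?thesis by blast
qed

section \<open>Polynomiality and the recursion for p_k\<close>

lemma weight_poly: "\<exists>w. \<forall>t. poly w t = weight j t"
proof -
  have "poly (smult (real (B_at_1 (2 * j + 1)) * 2 ^ j / fact (2 * j + 1)) (\<Prod>i<j. [:- 1 - real i, 1:])) t
      = weight j t" for t
    by (simp add: weight_def falling_def poly_prod algebra_simps)
  then show ?thesis by blast
qed

text \<open>By induction on \<open>k\<close>, the increments of \<open>ratio k\<close> are values of
  a polynomial, and so is their indefinite sum.\<close>

lemma ratio_poly: "\<exists>p. \<forall>n\<ge>k + 1. ratio k n = poly p (real n)"
proof (induction k rule: less_induct)
  case (less k)
  then have "\<forall>i. \<exists>p. i < k \<longrightarrow> (\<forall>n\<ge>i + 1. ratio i n = poly p (real n))" by blast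
  then obtain p where p: "\<And>i n. i < k \<Longrightarrow> n \<ge> i + 1 \<Longrightarrow> ratio i n = poly (p i) (real n)"
    by metis
  obtain w where w: "\<And>j t. poly (w j) t = weight j t" using weight_poly by metis
  \<comment> \<open>The composition shifts the argument: at Suc n it evaluates
    \<open>p (k - j)\<close> at n-j = (n+1)-j-1.\<close>
  let ?P = "\<Sum>j=1..k. w j * pcompose (p (k - j)) [:- real j - 1, 1:]"
  obtain Q where Q: "\<And>x. poly Q x - poly Q (x - 1) = poly ?P x"
    using backward_difference_poly[of ?P] by blast
  \<comment> \<open>An antidifference is free up to a constant, chosen here to match the initial
    value at k+1.\<close>
  let ?p = "Q + [:ratio k (k + 1) - poly Q (real (k + 1)):]"
  have "ratio k n = poly ?p (real n)" if "n \<ge> k + 1" for n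
    using that
  proof (induction n rule: dec_induct)
    case base
    show ?case by simp
  next
    case (step n)
    have "(\<Sum>j=1..k. weight j (real (Suc n)) * ratio (k - j) (n - j)) = poly ?P (real (Suc n))"
      unfolding poly_sum
    proof (rule sum.cong[OF refl])
      fix j assume "j \<in> {1..k}"
      \<comment> \<open>From n \<ge> k+1 follows n-j \<ge> (k-j)+1, so the induction hypothesis
        applies at n-j.\<close>
      with step have j: "k - j < k" "n - j \<ge> k - j + 1" "j \<le> n" by auto
      from p[OF j(1,2)] j(3) show "weight j (real (Suc n)) * ratio (k - j) (n - j) =
          poly (w j * pcompose (p (k - j)) [:- real j - 1, 1:]) (real (Suc n))"
        by (simp add: w poly_pcompose of_nat_diff)
    qed
    then show ?case
      using step ratio_step[of k n] Q[of "real (Suc n)"] by simp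
  qed
  then show ?case by blast
qed

lemma ratio_0: "n \<ge> 1 \<Longrightarrow> ratio 0 n = 1"
  using ratio_sum[of 0 n] B_at_1_1 by (simp add: odd_double_fact_def)

theorem theorem3p3:
  shows "\<exists>p :: nat \<Rightarrow> real poly.
    (\<forall>k n. n \<ge> k + 1 \<longrightarrow>
       real (A (2 * n) (n + k)) = poly (p k) (real n) * real (odd_double_fact n)) \<and>
    p 0 = 1 \<and>
    (\<forall>k n. k \<ge> 1 \<longrightarrow> n \<ge> k + 1 \<longrightarrow>
       poly (p k) (real n) =
         real (B_at_1 (2 * k + 1)) / real (odd_double_fact (k + 1)) +
         (\<Sum>j=1..k. \<Sum>t=k+2..n.
            real (B_at_1 (2 * j + 1)) * 2 ^ j * falling (real t - 1) j / fact (2 * j + 1) *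
            poly (p (k - j)) (real t - real j - 1)))"
proof -
  obtain p' where p': "\<And>k n. n \<ge> k + 1 \<Longrightarrow> ratio k n = poly (p' k) (real n)"
    using ratio_poly by metis
  \<comment> \<open>The chosen \<open>p' 0\<close> is only known to take the value 1 at every n
    \<ge> 1. Replacing it by the constant 1 makes \<open>p 0 = 1\<close> an identity of polynomials
    and keeps these values.\<close>
  define p where "p = p'(0 := 1)"
  have p: "ratio k n = poly (p k) (real n)" if "n \<ge> k + 1" for k n
    using p'[OF that] ratio_0[of n] that by (cases "k = 0") (simp_all add: p_def)
  show ?thesis
  proof (intro exI[of _ p] conjI allI impI)
    fix k n :: nat assume "n \<ge> k + 1"
    from p[OF this] show "real (A (2 * n) (n + k)) = poly (p k) (real n) * real (odd_double_fact n)"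
      using odd_double_fact_pos[of n] by (simp add: ratio_def field_simps)
  next
    show "p 0 = 1" by (simp add: p_def)
  next
    fix k n :: nat assume n: "n \<ge> k + 1"
    have "ratio (k - j) (t - j - 1) = poly (p (k - j)) (real t - real j - 1)"
      if "j \<in> {1..k}" "t \<in> {k+2..n}" for j t
    proof -
      \<comment> \<open>Since t \<ge> k+2, the natural subtraction is exact and its result lies in
        the range where \<open>p (k - j)\<close> represents the ratio.\<close>
      have "real (t - j - 1) = real t - real j - 1" "t - j - 1 \<ge> k - j + 1"
        using that by (auto simp: of_nat_diff)
      with p[of "k - j" "t - j - 1"] show ?thesis by (simp only:)
    qed
    then have "(\<Sum>j=1..k. \<Sum>t=k+2..n. weight j (real t) * ratio (k - j) (t - j - 1)) =
        (\<Sum>j=1..k. \<Sum>t=k+2..n. weight j (real t) * poly (p (k - j)) (real t - real j - 1))"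
      by (intro sum.cong) auto
    with ratio_sum[OF n] p[OF n]
    show "poly (p k) (real n) =
         real (B_at_1 (2 * k + 1)) / real (odd_double_fact (k + 1)) +
         (\<Sum>j=1..k. \<Sum>t=k+2..n.
            real (B_at_1 (2 * j + 1)) * 2 ^ j * falling (real t - 1) j / fact (2 * j + 1) *
            poly (p (k - j)) (real t - real j - 1))"
      unfolding weight_def by simp
  qed
qed

end
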